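(* In $\mathbf{Sol}$ space, the isosceles property of a translation triangle is not equivalent to two angles of the triangle being equal. That is, it is not true that for every translation triangle $A_1A_2A_3$ in $\mathbf{Sol}$ the following two conditions are equivalent: (i) at least two of the side lengths $d^t(A_1,A_2)$, $d^t(A_1,A_3)$, $d^t(A_2,A_3)$ are equal; (ii) at least two of the interior angles $\omega_1,\omega_2,\omega_3$ are equal.
   Context: $\mathbf{Sol}$ is $\mathbb{R}^3$ with the group multiplication $(a,b,c)(x,y,z)=(x+ae^{-z},\,y+be^{z},\,z+c)$ and the Riemannian metric $ds^2=e^{2z}dx^2+e^{-2z}dy^2+dz^2$. For $P=(x,y,z)$ the translation $\tau_P$ is the map $(a,b,c)\mapsto (a,b,c)(x,y,z)=(x+ae^{-z},\,y+be^{z},\,z+c)$; it is an isometry taking the origin $O=(0,0,0)$ to $P$. Translation curves starting at the origin with initial tangent vector $(u,v,w)$ are the solutions of $\dot x=ue^{-z}$, $\dot y=ve^{z}$, $\dot z=w$, $x(0)=y(0)=z(0)=0$, i.e. $x(t)=-\frac{u}{w}(e^{-wt}-1)$, $y(t)=\frac{v}{w}(e^{wt}-1)$, $z(t)=wt$ if $w\neq0$, and $x(t)=ut$, $y(t)=vt$, $z(t)=0$ if $w=0$. Translation curves starting at an arbitrary point $P$ are the images under $\tau_P$ of translation curves starting at $O$. Between any two distinct points $P_1,P_2$ there is a unique translation curve segment starting at $P_1$ and ending at $P_2$ (up to parametrization); the translation distance $d^t(P_1,P_2)$ is its arc length with respect to the metric above. A translation triangle $A_1A_2A_3$ is given by three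 points $A_1,A_2,A_3$ of $\mathbf{Sol}$ that do not all lie on the same translation curve; its sides are the translation curve segments connecting the vertices, and the length of the side $A_iA_j$ is $d^t(A_i,A_j)$. The triangle is isosceles if at least two of its sides have equal length. The interior angle $\omega_i\in[0,\pi]$ at the vertex $A_i$ is the angle, measured with the Riemannian metric at $A_i$, between the tangent vectors at $A_i$ of the translation curve segments starting at $A_i$ and ending at the two other vertices. *)

theory Defs
  imports "HOL-Analysis.Analysis"
begin

text \<open>Points of Sol, and tangent vectors written in the coordinate basis, are triples of
  reals. Only the topology and the vector space structure of the product type are used,
  not its Euclidean norm.\<close>

type_synonym sol_point = "real \<times> real \<times> real"
type_synonym sol_vector = "real \<times> real \<times> real"

fun sol_mult :: "sol_point \<Rightarrow> sol_point \<Rightarrow> sol_point" where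
  "sol_mult (a, b, c) (x, y, z) = (x + a * exp (- z), y + b * exp z, z + c)"

definition sol_translation :: "sol_point \<Rightarrow> sol_point \<Rightarrow> sol_point" where
  "sol_translation P A = sol_mult A P"

fun sol_metric :: "sol_point \<Rightarrow> sol_vector \<Rightarrow> sol_vector \<Rightarrow> real" where
  "sol_metric (x, y, z) (a, b, c) (a', b', c') =
     exp (2 * z) * (a * a') + exp (- 2 * z) * (b * b') + c * c'"

definition sol_norm :: "sol_point \<Rightarrow> sol_vector \<Rightarrow> real" where
  "sol_norm P X = sqrt (sol_metric P X X)"

fun sol_field :: "sol_vector \<Rightarrow> sol_point \<Rightarrow> sol_vector" where
  "sol_field (u, v, w) (x, y, z) = (u * exp (- z), v * exp z, w)"

definition origin_translation_curve :: "sol_vector \<Rightarrow> (real \<Rightarrow> sol_point) \<Rightarrow> bool" where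
  "origin_translation_curve U \<gamma> \<longleftrightarrow>
     \<gamma> 0 = (0, 0, 0) \<and> (\<forall>t. (\<gamma> has_vector_derivative sol_field U (\<gamma> t)) (at t))"

definition translation_curve :: "sol_point \<Rightarrow> (real \<Rightarrow> sol_point) \<Rightarrow> bool" where
  "translation_curve P c \<longleftrightarrow>
     (\<exists>U \<gamma>. origin_translation_curve U \<gamma> \<and> c = sol_translation P \<circ> \<gamma>)"

text \<open>The segment from \<open>P\<close> to \<open>Q\<close> is parametrized on \<open>[0, 1]\<close>. This fixes the
  parametrization, which makes the curve unique; see \<open>translation_segment_ex1\<close> below.\<close>

definition translation_segment :: "sol_point \<Rightarrow> sol_point \<Rightarrow> real \<Rightarrow> sol_point" where
  "translation_segment P Q = (THE c. translation_curve P c \<and> c 1 = Q)"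

definition sol_arc_length :: "(real \<Rightarrow> sol_point) \<Rightarrow> real" where
  "sol_arc_length c = integral {0..1} (\<lambda>t. sol_norm (c t) (vector_derivative c (at t)))"

definition translation_dist :: "sol_point \<Rightarrow> sol_point \<Rightarrow> real" where
  "translation_dist P Q = sol_arc_length (translation_segment P Q)"

definition sol_angle :: "sol_point \<Rightarrow> sol_vector \<Rightarrow> sol_vector \<Rightarrow> real" where
  "sol_angle P X Y = arccos (sol_metric P X Y / (sol_norm P X * sol_norm P Y))"

definition interior_angle :: "sol_point \<Rightarrow> sol_point \<Rightarrow> sol_point \<Rightarrow> real" where
  "interior_angle A B C =
     sol_angle A (vector_derivative (translation_segment A B) (at 0))
                 (vector_derivative (translation_segment A C) (at 0))"

text \<open>Curves are parametrized over the whole real line. If two of the points coincide, the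
  three points lie on a common translation curve, so the vertices of a triangle are
  pairwise distinct.\<close>

definition translation_triangle :: "sol_point \<Rightarrow> sol_point \<Rightarrow> sol_point \<Rightarrow> bool" where
  "translation_triangle A\<^sub>1 A\<^sub>2 A\<^sub>3 \<longleftrightarrow>
     \<not> (\<exists>P c. translation_curve P c \<and> {A\<^sub>1, A\<^sub>2, A\<^sub>3} \<subseteq> range c)"

definition isosceles :: "sol_point \<Rightarrow> sol_point \<Rightarrow> sol_point \<Rightarrow> bool" where
  "isosceles A\<^sub>1 A\<^sub>2 A\<^sub>3 \<longleftrightarrow>
     translation_dist A\<^sub>1 A\<^sub>2 = translation_dist A\<^sub>1 A\<^sub>3 \<or>
     translation_dist A\<^sub>1 A\<^sub>2 = translation_dist A\<^sub>2 A\<^sub>3 \<or>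
     translation_dist A\<^sub>1 A\<^sub>3 = translation_dist A\<^sub>2 A\<^sub>3"

definition two_equal_angles :: "sol_point \<Rightarrow> sol_point \<Rightarrow> sol_point \<Rightarrow> bool" where
  "two_equal_angles A\<^sub>1 A\<^sub>2 A\<^sub>3 \<longleftrightarrow>
     interior_angle A\<^sub>1 A\<^sub>2 A\<^sub>3 = interior_angle A\<^sub>2 A\<^sub>1 A\<^sub>3 \<or>
     interior_angle A\<^sub>1 A\<^sub>2 A\<^sub>3 = interior_angle A\<^sub>3 A\<^sub>1 A\<^sub>2 \<or>
     interior_angle A\<^sub>2 A\<^sub>1 A\<^sub>3 = interior_angle A\<^sub>3 A\<^sub>1 A\<^sub>2"


subsection \<open>Explicit form, existence and uniqueness of segments\<close>

fun origin_curve :: "sol_vector \<Rightarrow> real \<Rightarrow> sol_point" where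
  "origin_curve (u, v, w) t =
     (if w = 0 then (u * t, v * t, 0)
      else (- (u / w) * (exp (- w * t) - 1), v / w * (exp (w * t) - 1), w * t))"

lemma has_vector_derivative_triple_iff:
  fixes f g h :: "real \<Rightarrow> real" and s :: real
  shows "((\<lambda>t. (f t, g t, h t)) has_vector_derivative (a, b, c)) (at s) \<longleftrightarrow>
    (f has_vector_derivative a) (at s) \<and> (g has_vector_derivative b) (at s) \<and> (h has_vector_derivative c) (at s)"
proof
  assume L: "((\<lambda>t. (f t, g t, h t)) has_vector_derivative (a, b, c)) (at s)"
  have 1: "(f has_vector_derivative a) (at s)"
    using bounded_linear.has_vector_derivative[OF bounded_linear_fst L] by simp
  have 2: "((\<lambda>t. (g t, h t)) has_vector_derivative (b, c)) (at s)"
    using bounded_linear.has_vector_derivative[OF bounded_linear_snd L] by simp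
  show "(f has_vector_derivative a) (at s) \<and> (g has_vector_derivative b) (at s) \<and> (h has_vector_derivative c) (at s)"
    using 1 bounded_linear.has_vector_derivative[OF bounded_linear_fst 2]
      bounded_linear.has_vector_derivative[OF bounded_linear_snd 2] by simp
next
  assume "(f has_vector_derivative a) (at s) \<and> (g has_vector_derivative b) (at s) \<and> (h has_vector_derivative c) (at s)"
  then show "((\<lambda>t. (f t, g t, h t)) has_vector_derivative (a, b, c)) (at s)"
    by (auto intro!: has_vector_derivative_Pair)
qed

lemma origin_curve_solves: "origin_translation_curve U (origin_curve U)"
proof -
  obtain u v w where U: "U = (u, v, w)" by (cases U)
  show ?thesis
  proof (cases "w = 0")
    case True
    then have e: "origin_curve U = (\<lambda>t. (u * t, v * t, 0))" by (auto simp: U)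
    show ?thesis
      unfolding origin_translation_curve_def e
      by (auto simp: U True has_vector_derivative_triple_iff
          simp flip: has_real_derivative_iff_has_vector_derivative intro!: derivative_eq_intros)
  next
    case False
    then have e: "origin_curve U =
        (\<lambda>t. (- (u / w) * (exp (- w * t) - 1), v / w * (exp (w * t) - 1), w * t))"
      by (auto simp: U)
    show ?thesis
      unfolding origin_translation_curve_def e using False
      by (auto simp: U has_vector_derivative_triple_iff
          simp flip: has_real_derivative_iff_has_vector_derivative intro!: derivative_eq_intros)
  qed
qed

lemma origin_translation_curve_iff: "origin_translation_curve U \<gamma> \<longleftrightarrow> \<gamma> = origin_curve U"
proof
  assume A: "origin_translation_curve U \<gamma>"
  obtain u v w where U: "U = (u, v, w)" by (cases U)
  have same: "f = g"
    if "f 0 = g 0" "\<And>t. (f has_vector_derivative D t) (at t)" "\<And>t. (g has_vector_derivative D t) (at t)"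
    for f g :: "real \<Rightarrow> real" and D
  proof
    fix t
    have "((\<lambda>s. f s - g s) has_real_derivative 0) (at s)" for s
      using has_vector_derivative_diff[OF that(2,3)[of s]]
      by (simp add: has_real_derivative_iff_has_vector_derivative)
    then have "f t - g t = f 0 - g 0" by (intro DERIV_isconst_all) auto
    with that(1) show "f t = g t" by simp
  qed
  define x y z where "x = (\<lambda>t. fst (\<gamma> t))" and "y = (\<lambda>t. fst (snd (\<gamma> t)))"
    and "z = (\<lambda>t. snd (snd (\<gamma> t)))"
  define x' y' z' where "x' = (\<lambda>t. fst (origin_curve U t))"
    and "y' = (\<lambda>t. fst (snd (origin_curve U t)))" and "z' = (\<lambda>t. snd (snd (origin_curve U t)))"
  have g: "\<gamma> = (\<lambda>t. (x t, y t, z t))" by (simp add: x_def y_def z_def)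
  have g': "origin_curve U = (\<lambda>t. (x' t, y' t, z' t))" by (simp add: x'_def y'_def z'_def)
  have d: "x 0 = 0" "y 0 = 0" "z 0 = 0"
    "(x has_vector_derivative u * exp (- z t)) (at t)"
    "(y has_vector_derivative v * exp (z t)) (at t)"
    "(z has_vector_derivative w) (at t)" for t
    using A unfolding origin_translation_curve_def g
    by (auto simp: U has_vector_derivative_triple_iff)
  have d': "x' 0 = 0" "y' 0 = 0" "z' 0 = 0"
    "(x' has_vector_derivative u * exp (- z' t)) (at t)"
    "(y' has_vector_derivative v * exp (z' t)) (at t)"
    "(z' has_vector_derivative w) (at t)" for t
    using origin_curve_solves[of U] unfolding origin_translation_curve_def g'
    by (auto simp: U has_vector_derivative_triple_iff)
  have z: "z = z'" by (rule same[OF _ d(6) d'(6)]) (simp add: d d')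
  have x: "x = x'" by (rule same[OF _ d(4) d'(4)[folded z]]) (simp add: d d')
  have y: "y = y'" by (rule same[OF _ d(5) d'(5)[folded z]]) (simp add: d d')
  show "\<gamma> = origin_curve U" unfolding g g' x y z ..
qed (simp add: origin_curve_solves)

lemma translation_curve_iff:
  "translation_curve P c \<longleftrightarrow> (\<exists>U. c = sol_translation P \<circ> origin_curve U)"
  by (simp add: translation_curve_def origin_translation_curve_iff)

lemma origin_curve_1_ex1: "\<exists>!U. origin_curve U 1 = A"
proof -
  obtain a b c where A: "A = (a, b, c)" by (cases A)
  show ?thesis
  proof (cases "c = 0")
    case True
    show ?thesis
      by (rule ex1I[of _ "(a, b, 0)"]) (auto simp: A True split: if_splits)
  next
    case False
    then have n: "exp (- c) - 1 \<noteq> 0" "exp c - 1 \<noteq> 0" by auto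
    show ?thesis
    proof (rule ex1I[of _ "(- a * c / (exp (- c) - 1), b * c / (exp c - 1), c)"])
      show "origin_curve (- a * c / (exp (- c) - 1), b * c / (exp c - 1), c) 1 = A"
        using False n by (simp add: A)
    next
      fix U assume "origin_curve U 1 = A"
      moreover obtain u v w where U: "U = (u, v, w)" by (cases U)
      ultimately have "w = c" "a = - (u / c) * (exp (- c) - 1)" "b = v / c * (exp c - 1)"
        using False by (auto simp: A split: if_splits)
      then show "U = (- a * c / (exp (- c) - 1), b * c / (exp c - 1), c)"
        using False n by (simp add: U)
    qed
  qed
qed

lemma sol_translation_bij: "bij (sol_translation P)"
proof -
  obtain x y z where P: "P = (x, y, z)" by (cases P)
  show ?thesis
    by (rule o_bij[where g = "\<lambda>(a, b, c). ((a - x) * exp z, (b - y) * exp (- z), c - z)"])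
      (auto simp: P sol_translation_def fun_eq_iff exp_minus field_simps)
qed

lemma translation_segment_ex1: "\<exists>!c. translation_curve P c \<and> c 1 = Q"
proof -
  obtain A where A: "sol_translation P A = Q"
    using bij_is_surj[OF sol_translation_bij[of P]] by (metis surjD)
  obtain U where U: "origin_curve U 1 = A" using origin_curve_1_ex1 by blast
  show ?thesis
  proof (rule ex1I[of _ "sol_translation P \<circ> origin_curve U"])
    show "translation_curve P (sol_translation P \<circ> origin_curve U) \<and>
        (sol_translation P \<circ> origin_curve U) 1 = Q"
      using A U unfolding translation_curve_iff by (metis comp_apply)
  next
    fix c assume c: "translation_curve P c \<and> c 1 = Q"
    then obtain V where V: "c = sol_translation P \<circ> origin_curve V"
      by (auto simp: translation_curve_iff)
    with c A have "origin_curve V 1 = A"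
      using bij_is_inj[OF sol_translation_bij[of P]] by (auto dest: injD)
    with U have "V = U" using origin_curve_1_ex1 by blast
    with V show "c = sol_translation P \<circ> origin_curve U" by simp
  qed
qed

end

theory Submission
  imports Defs
begin

text \<open>
  In the orthonormal frame \<open>e\<^sup>-\<^sup>z \<partial>\<^sub>x, e\<^sup>z \<partial>\<^sub>y, \<partial>\<^sub>z\<close> the velocity of a translation curve has
  constant components \<open>U\<close>. So side lengths are Euclidean norms of the vectors \<open>U\<close>, and interior
  angles are Euclidean angles between them. For the vertices \<open>(0,0,0)\<close>, \<open>(1,0,0)\<close>, \<open>(0,0,1)\<close> the
  two sides at the origin have length 1 and are orthogonal, while the third side has components
  \<open>(- s, 0, 1)\<close> with \<open>s = e / (e - 1) > 1\<close>. The cosines of the three angles are in the ratio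
  \<open>0 : s : 1\<close>, hence distinct.
\<close>

lemma sol_metric_sol_field: "sol_metric P (sol_field U P) (sol_field V P) = U \<bullet> V"
proof (cases P; cases U; cases V)
  fix x y z u v w u' v' w'
  assume *: "P = (x, y, z)" "U = (u, v, w)" "V = (u', v', w')"
  have "exp (2 * z) * (exp (- z) * exp (- z)) = 1" "exp (- 2 * z) * (exp z * exp z) = 1"
    by (simp_all flip: exp_add)
  then have terms: "exp (2 * z) * (u * exp (- z) * (u' * exp (- z))) = u * u'"
    "exp (- 2 * z) * (v * exp z * (v' * exp z)) = v * v'"
    by algebra+
  show ?thesis unfolding * sol_field.simps sol_metric.simps terms by simp
qed

lemma sol_norm_sol_field: "sol_norm P (sol_field U P) = norm U"
  by (simp add: sol_norm_def sol_metric_sol_field norm_eq_sqrt_inner)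

text \<open>Translating by \<open>(p, q, r)\<close> scales the first two velocity components by
  \<open>exp (- r)\<close> and \<open>exp r\<close> and raises the height by \<open>r\<close>;
  \<open>sol_field U\<close> changes by the same factors, so the translated curve solves the same
  system.\<close>

lemma has_vector_derivative_translation_curve:
  assumes "c = sol_translation P \<circ> origin_curve U"
  shows "(c has_vector_derivative sol_field U (c t)) (at t)"
proof -
  obtain u v w where U: "U = (u, v, w)" by (cases U)
  obtain p q r where P: "P = (p, q, r)" by (cases P)
  define x y z where "x = (\<lambda>t. fst (origin_curve U t))"
    and "y = (\<lambda>t. fst (snd (origin_curve U t)))" and "z = (\<lambda>t. snd (snd (origin_curve U t)))"
  have g: "origin_curve U = (\<lambda>t. (x t, y t, z t))" by (simp add: x_def y_def z_def)
  have d: "(x has_real_derivative u * exp (- z t)) (at t)"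
    "(y has_real_derivative v * exp (z t)) (at t)"
    "(z has_real_derivative w) (at t)"
    using origin_curve_solves[of U] unfolding origin_translation_curve_def g
    by (auto simp: U has_vector_derivative_triple_iff has_real_derivative_iff_has_vector_derivative)
  have c: "c = (\<lambda>t. (p + x t * exp (- r), q + y t * exp r, r + z t))"
    by (auto simp: assms g P sol_translation_def)
  show ?thesis
    unfolding c U
    by (auto simp: has_vector_derivative_triple_iff exp_add exp_diff exp_minus divide_inverse mult_ac
        simp flip: has_real_derivative_iff_has_vector_derivative intro!: derivative_eq_intros d)
qed

lemma translation_segment_eqI:
  assumes "sol_translation P (origin_curve U 1) = Q"
  shows "translation_segment P Q = sol_translation P \<circ> origin_curve U"
  unfolding translation_segment_def
  by (rule the1_equality[OF translation_segment_ex1]) (use assms in \<open>auto simp: translation_curve_iff simp del: split_paired_Ex\<close>)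

lemma vector_derivative_translation_segment:
  assumes "sol_translation P (origin_curve U 1) = Q"
  shows "vector_derivative (translation_segment P Q) (at t) = sol_field U (translation_segment P Q t)"
  by (rule vector_derivative_at has_vector_derivative_translation_curve translation_segment_eqI assms)+

lemma translation_dist_eqI:
  assumes "sol_translation P (origin_curve U 1) = Q"
  shows "translation_dist P Q = norm U"
  by (simp add: translation_dist_def sol_arc_length_def sol_norm_sol_field
      vector_derivative_translation_segment[OF assms])

lemma interior_angle_eqI:
  assumes "sol_translation A (origin_curve U 1) = B" "sol_translation A (origin_curve V 1) = C"
  shows "interior_angle A B C = arccos (U \<bullet> V / (norm U * norm V))"
proof -
  \<comment> \<open>Both tangent vectors are thereby values of frame fields at the same point
    \<open>A\<close>, where the metric reduces to the inner product.\<close>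
  have start: "translation_segment A Q 0 = A" if "sol_translation A (origin_curve W 1) = Q" for W Q
    unfolding translation_segment_eqI[OF that]
    by (cases A; cases W) (simp add: sol_translation_def)
  show ?thesis
    by (simp add: interior_angle_def sol_angle_def sol_norm_sol_field sol_metric_sol_field
        vector_derivative_translation_segment[OF assms(1)] start[OF assms(1)]
        vector_derivative_translation_segment[OF assms(2)] start[OF assms(2)])
qed

text \<open>By Cauchy-Schwarz both quotients lie in [-1, 1], where \<open>arccos\<close> is
  injective; for a zero vector the quotient is 0 by the convention for division.\<close>

lemma arccos_cosine_eq_iff:
  fixes U V U' V' :: "'a::real_inner"
  shows "arccos (U \<bullet> V / (norm U * norm V)) = arccos (U' \<bullet> V' / (norm U' * norm V')) \<longleftrightarrow>
    U \<bullet> V / (norm U * norm V) = U' \<bullet> V' / (norm U' * norm V')"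
proof -
  have "\<bar>X \<bullet> Y / (norm X * norm Y)\<bar> \<le> 1" for X Y :: 'a
    using Cauchy_Schwarz_ineq2[of X Y] by (cases "X = 0 \<or> Y = 0") (auto simp: abs_mult)
  then show ?thesis by (simp add: arccos_eq_iff)
qed

text \<open>Height is affine in the parameter of a translation curve. A curve through points of
  different heights has nonzero slope \<open>w\<close>, hence meets each height only once.\<close>

lemma translation_triangle_horizontal_side:
  assumes "(x, y) \<noteq> (x', y')" "z' \<noteq> z"
  shows "translation_triangle (x, y, z) (x', y', z) (x'', y'', z')"
  unfolding translation_triangle_def
proof (intro notI, elim exE conjE)
  fix P c
  assume "translation_curve P c" and sub: "{(x, y, z), (x', y', z), (x'', y'', z')} \<subseteq> range c"
  then obtain U where c: "c = sol_translation P \<circ> origin_curve U"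
    by (auto simp: translation_curve_iff)
  obtain p q r where P: "P = (p, q, r)" by (cases P)
  obtain u v w where U: "U = (u, v, w)" by (cases U)
  have height: "snd (snd (c t)) = w * t + r" for t
    by (simp add: c P U sol_translation_def)
  obtain t1 t2 t3 where t: "c t1 = (x, y, z)" "c t2 = (x', y', z)" "c t3 = (x'', y'', z')"
    using sub by (simp add: image_iff) metis
  have "w * t1 + r = z" "w * t2 + r = z" "w * t3 + r = z'"
    by (simp_all add: t flip: height)
  then have "w * t1 = w * t2" "w \<noteq> 0" using assms by auto
  then have "t1 = t2" by simp
  then show False using assms t by simp
qed

theorem proposition3p4:
  "\<not> (\<forall>A\<^sub>1 A\<^sub>2 A\<^sub>3. translation_triangle A\<^sub>1 A\<^sub>2 A\<^sub>3 \<longrightarrow>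
         (isosceles A\<^sub>1 A\<^sub>2 A\<^sub>3 \<longleftrightarrow> two_equal_angles A\<^sub>1 A\<^sub>2 A\<^sub>3))"
proof -
  define s where "s = exp 1 / (exp 1 - 1 :: real)"
  have e: "exp 1 > (1 :: real)" by simp
  have s: "s > 1" using e by (simp add: s_def field_simps)
  let ?A = "(0, 0, 0) :: sol_point" and ?B = "(1, 0, 0) :: sol_point" and ?C = "(0, 0, 1) :: sol_point"
  \<comment> \<open>Reversing a side negates its vector. The value \<open>s\<close> comes from
    \<open>?C\<close> to \<open>?B\<close>: the first coordinate at time 1 is
    \<open>u * (exp 1 - 1) * exp (- 1)\<close>, which must equal 1.\<close>
  have AB: "sol_translation ?A (origin_curve (1, 0, 0) 1) = ?B"
    and AC: "sol_translation ?A (origin_curve (0, 0, 1) 1) = ?C"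
    and BA: "sol_translation ?B (origin_curve (- 1, 0, 0) 1) = ?A"
    and BC: "sol_translation ?B (origin_curve (- s, 0, 1) 1) = ?C"
    and CA: "sol_translation ?C (origin_curve (0, 0, - 1) 1) = ?A"
    and CB: "sol_translation ?C (origin_curve (s, 0, - 1) 1) = ?B"
    using e by (simp_all add: sol_translation_def s_def exp_minus field_simps)
  have "translation_triangle ?A ?B ?C"
    by (rule translation_triangle_horizontal_side) auto
  moreover have "isosceles ?A ?B ?C"
    by (simp add: isosceles_def translation_dist_eqI[OF AB] translation_dist_eqI[OF AC] norm_Pair)
  moreover have "\<not> two_equal_angles ?A ?B ?C"
    using s
    unfolding two_equal_angles_def interior_angle_eqI[OF AB AC] interior_angle_eqI[OF BA BC]
      interior_angle_eqI[OF CA CB] arccos_cosine_eq_iff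
    by (simp add: norm_Pair add_nonneg_eq_0_iff)
  ultimately show ?thesis by blast
qed

end
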